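(* Let $S$ be a distributive $\{\vee,0\}$-semilattice. Then the following are equivalent: (i) For any Boolean algebra $B$, any $\{\vee,0\}$-homomorphism $\mu\colon B\to S$, and any $a_0,a_1\in S$ such that $\mu(1_B)=a_0\vee a_1$, there are $\{\vee,0\}$-homomorphisms $\mu_0,\mu_1\colon B\to S$ such that $\mu=\mu_0\vee\mu_1$ (that is, $\mu(x)=\mu_0(x)\vee\mu_1(x)$ for all $x\in B$) and $\mu_\ell(1_B)=a_\ell$ for all $\ell\in\{0,1\}$. (ii) $S$ is a lattice.
   Context: A $\{\vee,0\}$-semilattice is a join-semilattice with a least element $0$; a $\{\vee,0\}$-homomorphism is a map preserving binary joins and $0$. A $\{\vee,0\}$-semilattice $S$ is distributive if for all $a,b,c\in S$ with $a\le b\vee c$ there are $b'\le b$ and $c'\le c$ in $S$ with $a=b'\vee c'$. "$S$ is a lattice" means that any two elements of $S$ have a greatest lower bound in the order of $S$. *)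

theory Defs
  imports Main
begin

(* Boolean algebras with an explicit carrier: the axioms are those of the locale
   abstract_boolean_algebra of HOL.Boolean_Algebras, relativised to A.  The one-element
   algebra is allowed. *)
locale boolean_algebra_on =
  fixes A :: "'b set"
    and meet :: "'b \<Rightarrow> 'b \<Rightarrow> 'b"
    and join :: "'b \<Rightarrow> 'b \<Rightarrow> 'b"
    and cmpl :: "'b \<Rightarrow> 'b"
    and zero :: 'b
    and one :: 'b
  assumes meet_closed: "x \<in> A \<Longrightarrow> y \<in> A \<Longrightarrow> meet x y \<in> A"
    and join_closed: "x \<in> A \<Longrightarrow> y \<in> A \<Longrightarrow> join x y \<in> A"
    and cmpl_closed: "x \<in> A \<Longrightarrow> cmpl x \<in> A"
    and zero_closed: "zero \<in> A"
    and one_closed: "one \<in> A"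
    and meet_assoc: "x \<in> A \<Longrightarrow> y \<in> A \<Longrightarrow> z \<in> A \<Longrightarrow> meet (meet x y) z = meet x (meet y z)"
    and meet_commute: "x \<in> A \<Longrightarrow> y \<in> A \<Longrightarrow> meet x y = meet y x"
    and join_assoc: "x \<in> A \<Longrightarrow> y \<in> A \<Longrightarrow> z \<in> A \<Longrightarrow> join (join x y) z = join x (join y z)"
    and join_commute: "x \<in> A \<Longrightarrow> y \<in> A \<Longrightarrow> join x y = join y x"
    and meet_join_distrib:
      "x \<in> A \<Longrightarrow> y \<in> A \<Longrightarrow> z \<in> A \<Longrightarrow> meet x (join y z) = join (meet x y) (meet x z)"
    and join_meet_distrib:
      "x \<in> A \<Longrightarrow> y \<in> A \<Longrightarrow> z \<in> A \<Longrightarrow> join x (meet y z) = meet (join x y) (join x z)"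
    and meet_one_right: "x \<in> A \<Longrightarrow> meet x one = x"
    and join_zero_right: "x \<in> A \<Longrightarrow> join x zero = x"
    and meet_cancel_right: "x \<in> A \<Longrightarrow> meet x (cmpl x) = zero"
    and join_cancel_right: "x \<in> A \<Longrightarrow> join x (cmpl x) = one"

lemma boolean_algebra_on_UNIV:
  "boolean_algebra_on (UNIV :: 'b::boolean_algebra set) inf sup uminus bot top"
  by unfold_locales
    (rule UNIV_I inf_assoc inf_commute sup_assoc sup_commute inf_sup_distrib1 sup_inf_distrib1
      inf_top_right sup_bot_right inf_compl_bot sup_compl_top)+

(* The semilattice S is the whole type 'a; values of the map outside A are irrelevant. *)
definition join_zero_hom_on ::
  "'b set \<Rightarrow> ('b \<Rightarrow> 'b \<Rightarrow> 'b) \<Rightarrow> 'b \<Rightarrow> ('b \<Rightarrow> 'a::bounded_semilattice_sup_bot) \<Rightarrow> bool"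
where
  "join_zero_hom_on A join zero \<mu> \<longleftrightarrow>
     \<mu> zero = bot \<and> (\<forall>x\<in>A. \<forall>y\<in>A. \<mu> (join x y) = sup (\<mu> x) (\<mu> y))"

(* The splitting condition for all Boolean algebras whose carrier is a subset of the type 'b.  HOL
   cannot quantify over types inside a formula, so 'b is a parameter.  The equivalence "splitting
   for every Boolean algebra iff S is a lattice" is therefore expressed by two facts: being a
   lattice implies hom_splitting_property for an arbitrary 'b, and hom_splitting_property for one
   sufficiently large type, 'a set set, implies being a lattice. *)
definition hom_splitting_property ::
  "'b itself \<Rightarrow> 'a::bounded_semilattice_sup_bot itself \<Rightarrow> bool"
where
  "hom_splitting_property TB TS \<longleftrightarrow>
     (\<forall>(A :: 'b set) meet join cmpl zero one (\<mu> :: 'b \<Rightarrow> 'a) a0 a1.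
        boolean_algebra_on A meet join cmpl zero one \<longrightarrow>
        join_zero_hom_on A join zero \<mu> \<longrightarrow>
        \<mu> one = sup a0 a1 \<longrightarrow>
        (\<exists>\<mu>0 \<mu>1 :: 'b \<Rightarrow> 'a.
           join_zero_hom_on A join zero \<mu>0 \<and>
           join_zero_hom_on A join zero \<mu>1 \<and>
           (\<forall>x\<in>A. \<mu> x = sup (\<mu>0 x) (\<mu>1 x)) \<and>
           \<mu>0 one = a0 \<and> \<mu>1 one = a1))"

definition distributive_semilattice :: "'a::bounded_semilattice_sup_bot itself \<Rightarrow> bool"
where
  "distributive_semilattice TS \<longleftrightarrow>
     (\<forall>a b c :: 'a. a \<le> sup b c \<longrightarrow> (\<exists>b' c'. b' \<le> b \<and> c' \<le> c \<and> a = sup b' c'))"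

definition semilattice_is_lattice :: "'a::bounded_semilattice_sup_bot itself \<Rightarrow> bool"
where
  "semilattice_is_lattice TS \<longleftrightarrow>
     (\<forall>a b :: 'a. \<exists>m. m \<le> a \<and> m \<le> b \<and> (\<forall>c. c \<le> a \<and> c \<le> b \<longrightarrow> c \<le> m))"

end

theory Submission
  imports Defs
begin

text \<open>
  If \<open>S\<close> is a lattice, it is a distributive one and \<open>\<mu>\<^sub>l x = \<mu> x \<and> a\<^sub>l\<close> splits \<open>\<mu>\<close>.

  Conversely, let \<open>a\<close>, \<open>b\<close> be elements whose set \<open>I\<close> of common lower bounds has no largest element.
  Consider the grid with one row for every map \<open>i\<close> and one column for every element \<open>j\<close>,
  put the weight \<open>i j\<close> on the cell \<open>(i, j)\<close> whenever \<open>i j \<in> I\<close>, and let \<open>\<mu>\<close> send a finite set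
  of cells to the join of its weights, an infinite set covered by finitely many rows to \<open>a\<close>, an
  infinite set covered by finitely many columns to \<open>b\<close>, and any other set to \<open>a \<or> b\<close>.
  In a splitting of \<open>\<mu>\<close> along \<open>a\<close>, \<open>b\<close>, the value \<open>u\<^sub>i\<close> of \<open>\<mu>\<^sub>1\<close> at row \<open>i\<close> and the value \<open>v\<^sub>j\<close> of
  \<open>\<mu>\<^sub>0\<close> at column \<open>j\<close> both lie in \<open>I\<close>, and \<open>i j \<le> u\<^sub>i \<or> v\<^sub>j\<close> whenever \<open>i j \<in> I\<close>. Diagonalising,
  choose \<open>i\<close> with \<open>i j \<in> I\<close> and not \<open>i j \<le> j \<or> v\<^sub>j\<close> for all \<open>j \<in> I\<close>; then \<open>j = u\<^sub>i\<close> is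
  contradictory.
\<close>

section \<open>Splitting in a lattice\<close>

lemma join_zero_hom_on_mono:
  fixes \<mu> :: "'b \<Rightarrow> 'a::bounded_semilattice_sup_bot"
  assumes "join_zero_hom_on A join zero \<mu>" "x \<in> A" "y \<in> A" "join x y = y"
  shows "\<mu> x \<le> \<mu> y"
proof -
  have "\<mu> y = sup (\<mu> x) (\<mu> y)"
    using assms by (metis join_zero_hom_on_def)
  then show ?thesis
    by (metis sup_ge1)
qed

lemma (in boolean_algebra_on) join_one_right:
  assumes "x \<in> A"
  shows "join x one = one"
proof -
  have "join x one = join x (join x (cmpl x))"
    using assms by (simp add: join_cancel_right)
  also have "\<dots> = join (join x x) (cmpl x)"
    using assms by (simp add: join_assoc cmpl_closed)
  \<comment> \<open>Idempotence: distribute \<open>join x\<close> over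
    \<open>meet x (cmpl x) = zero\<close>.\<close>
  also have "join x x = meet (join x x) (join x (cmpl x))"
    using assms by (simp add: join_cancel_right meet_one_right join_closed)
  also have "\<dots> = x"
    using assms
    by (simp add: join_meet_distrib[symmetric] cmpl_closed meet_cancel_right join_zero_right)
  finally show ?thesis
    using assms by (simp add: join_cancel_right)
qed

lemma lattice_imp_hom_splitting_property:
  assumes dist: "distributive_semilattice TYPE('a::bounded_semilattice_sup_bot)"
    and lat: "semilattice_is_lattice TYPE('a)"
  shows "hom_splitting_property TYPE('b) TYPE('a)"
  unfolding hom_splitting_property_def
proof (intro allI impI)
  fix A :: "'b set" and meet join cmpl zero one and \<mu> :: "'b \<Rightarrow> 'a" and a0 a1
  assume "boolean_algebra_on A meet join cmpl zero one"
    and hom: "join_zero_hom_on A join zero \<mu>"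
    and one: "\<mu> one = sup a0 a1"
  then interpret boolean_algebra_on A meet join cmpl zero one
    by simp
  from lat obtain m :: "'a \<Rightarrow> 'a \<Rightarrow> 'a" where m1: "m x y \<le> x" and m2: "m x y \<le> y"
    and m3: "c \<le> x \<Longrightarrow> c \<le> y \<Longrightarrow> c \<le> m x y" for x y c
    unfolding semilattice_is_lattice_def by metis
  have m_mono: "m x z \<le> m y z" if "x \<le> y" for x y z
    using that by (meson m1 m2 m3 order_trans)
  have m_commute: "m x y = m y x" for x y
    by (meson m1 m2 m3 order_antisym)
  have m_sup: "m (sup x y) z = sup (m x z) (m y z)" for x y z
  proof (rule order_antisym)
    \<comment> \<open>Distributivity of the semilattice cuts the meet into parts below
      \<open>x\<close> and \<open>y\<close>. Both parts stay below \<open>z\<close>, hence below the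
      respective meets.\<close>
    obtain x' y' where x': "x' \<le> x" and y': "y' \<le> y" and *: "m (sup x y) z = sup x' y'"
      using dist m1 unfolding distributive_semilattice_def by meson
    then have "x' \<le> m x z" "y' \<le> m y z"
      by (metis m2 m3 order_trans sup_ge1) (metis * m2 m3 order_trans sup_ge2 y')
    then show "m (sup x y) z \<le> sup (m x z) (m y z)"
      unfolding * by (rule sup_mono)
  qed (simp add: m_mono)
  have split: "\<mu> x = sup (m (\<mu> x) a0) (m (\<mu> x) a1)" if "x \<in> A" for x
  proof -
    have "\<mu> x \<le> sup a0 a1"
      unfolding one[symmetric]
      by (rule join_zero_hom_on_mono[OF hom that one_closed join_one_right[OF that]])
    then have "\<mu> x = m (sup a0 a1) (\<mu> x)"
      by (meson m2 m3 order_antisym order_refl)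
    then show ?thesis
      by (metis m_sup m_commute)
  qed
  have homm: "join_zero_hom_on A join zero (\<lambda>x. m (\<mu> x) c)" for c
  proof -
    have "m bot c = bot"
      by (metis m1 bot_unique)
    with hom show ?thesis
      by (simp add: join_zero_hom_on_def m_sup)
  qed
  have "m (\<mu> one) a0 = a0" "m (\<mu> one) a1 = a1"
    unfolding one by (meson m2 m3 order_antisym order_refl sup_ge1 sup_ge2)+
  with homm split
  show "\<exists>\<mu>0 \<mu>1. join_zero_hom_on A join zero \<mu>0 \<and> join_zero_hom_on A join zero \<mu>1 \<and>
      (\<forall>x\<in>A. \<mu> x = sup (\<mu>0 x) (\<mu>1 x)) \<and> \<mu>0 one = a0 \<and> \<mu>1 one = a1"
    by (intro exI[of _ "\<lambda>x. m (\<mu> x) a0"] exI[of _ "\<lambda>x. m (\<mu> x) a1"]) auto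
qed

section \<open>Transport along injections, and an injection of the grid\<close>

lemma boolean_algebra_on_image:
  assumes "boolean_algebra_on A meet join cmpl zero one" and inj: "inj f"
  shows "boolean_algebra_on (f ` A) (\<lambda>x y. f (meet (inv f x) (inv f y)))
    (\<lambda>x y. f (join (inv f x) (inv f y))) (\<lambda>x. f (cmpl (inv f x))) (f zero) (f one)"
proof -
  interpret boolean_algebra_on A meet join cmpl zero one
    by fact
  show ?thesis
  proof (unfold_locales, goal_cases)
    case (10 x y z)
    then show ?case
      by (auto simp: inv_f_f[OF inj] meet_closed join_closed meet_join_distrib)
  next
    case (11 x y z)
    then show ?case
      by (auto simp: inv_f_f[OF inj] meet_closed join_closed join_meet_distrib)
  qed (auto simp: inv_f_f[OF inj] meet_closed join_closed cmpl_closed zero_closed one_closed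
      meet_assoc join_assoc meet_one_right join_zero_right meet_cancel_right join_cancel_right
      intro: arg_cong[where f = f, OF meet_commute] arg_cong[where f = f, OF join_commute])
qed

text \<open>Carry the algebra over to the image of \<open>f\<close>, split there, and compose both
  halves with \<open>f\<close>. The image may be a proper subset of the type, which the explicit
  carrier allows.\<close>

lemma hom_splitting_property_inj:
  fixes f :: "'c \<Rightarrow> 'b"
  assumes inj: "inj f"
    and split: "hom_splitting_property TYPE('b) TYPE('a::bounded_semilattice_sup_bot)"
  shows "hom_splitting_property TYPE('c) TYPE('a)"
  unfolding hom_splitting_property_def
proof (intro allI impI)
  fix A :: "'c set" and meet join cmpl zero one and \<mu> :: "'c \<Rightarrow> 'a" and a0 a1
  assume ba: "boolean_algebra_on A meet join cmpl zero one"
    and hom: "join_zero_hom_on A join zero \<mu>"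
    and one: "\<mu> one = sup a0 a1"
  let ?join = "\<lambda>x y. f (join (inv f x) (inv f y))"
  have "join_zero_hom_on (f ` A) ?join (f zero) (\<mu> \<circ> inv f)"
    using hom by (simp add: join_zero_hom_on_def inj)
  then obtain \<nu>0 \<nu>1 :: "'b \<Rightarrow> 'a"
    where "join_zero_hom_on (f ` A) ?join (f zero) \<nu>0" "join_zero_hom_on (f ` A) ?join (f zero) \<nu>1"
      "\<forall>x\<in>f ` A. (\<mu> \<circ> inv f) x = sup (\<nu>0 x) (\<nu>1 x)" "\<nu>0 (f one) = a0" "\<nu>1 (f one) = a1"
    using split[unfolded hom_splitting_property_def, rule_format,
        OF boolean_algebra_on_image[OF ba inj], of "\<mu> \<circ> inv f" a0 a1] one inj
    by auto
  then show "\<exists>\<mu>0 \<mu>1. join_zero_hom_on A join zero \<mu>0 \<and> join_zero_hom_on A join zero \<mu>1 \<and>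
      (\<forall>x\<in>A. \<mu> x = sup (\<mu>0 x) (\<mu>1 x)) \<and> \<mu>0 one = a0 \<and> \<mu>1 one = a1"
    by (intro exI[of _ "\<nu>0 \<circ> f"] exI[of _ "\<nu>1 \<circ> f"]) (simp add: join_zero_hom_on_def inj)
qed

text \<open>The cell \<open>(i, j)\<close> is coded by the graph of \<open>i\<close> with
  \<open>j\<close> attached to every point, the triples being flattened by \<open>g\<close>. The
  graph is nonempty, so \<open>j\<close> can be read off.\<close>

lemma infinite_imp_inj_grid:
  assumes "infinite (UNIV :: 'a set)"
  shows "\<exists>h :: ('a \<Rightarrow> 'a) \<times> 'a \<Rightarrow> 'a set. inj h"
proof -
  obtain g :: "'a \<times> 'a \<Rightarrow> 'a" where g: "inj g"
    using card_of_Times_same_infinite[OF assms]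
    unfolding card_of_ordIso[symmetric] by (auto simp: bij_betw_def)
  have "inj (\<lambda>(i, j). range (\<lambda>x. g (x, g (i x, j))))" (is "inj ?h")
  proof (rule injI)
    fix p q
    assume eq: "?h p = ?h q"
    obtain i j k l where pq: "p = (i, j)" "q = (k, l)"
      by fastforce
    have "i x = k x \<and> j = l" for x
    proof -
      have "g (x, g (i x, j)) \<in> ?h p"
        unfolding pq by simp
      then have "g (x, g (i x, j)) \<in> ?h q"
        unfolding eq .
      then show ?thesis
        unfolding pq by (auto simp: inj_eq[OF g])
    qed
    then show "p = q"
      unfolding pq by auto
  qed
  then show ?thesis
    by blast
qed

section \<open>The finite case, and the homomorphism on sets of grid cells\<close>

lemma finite_imp_meet:
  fixes a b :: "'a::bounded_semilattice_sup_bot"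
  assumes "finite {c. c \<le> a \<and> c \<le> b}"
  shows "\<exists>m. m \<le> a \<and> m \<le> b \<and> (\<forall>c. c \<le> a \<and> c \<le> b \<longrightarrow> c \<le> m)"
proof -
  let ?I = "{c. c \<le> a \<and> c \<le> b}"
  have "?I \<noteq> {}"
    by (auto intro: exI[of _ bot])
  \<comment> \<open>The join of the finitely many common lower bounds is the meet.\<close>
  then have "Sup_fin ?I \<le> a" "Sup_fin ?I \<le> b"
    by (auto intro!: Sup_fin.boundedI[OF assms])
  moreover have "c \<le> Sup_fin ?I" if "c \<le> a" "c \<le> b" for c
    using that by (intro Sup_fin.coboundedI[OF assms]) simp
  ultimately show ?thesis
    by blast
qed

text \<open>A finite image under \<open>fst\<close> means finitely many rows, under
  \<open>snd\<close> finitely many columns. Inserting \<open>bot\<close> gives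
  \<open>Sup_fin\<close> its value at the empty set.\<close>

definition grid_map ::
  "('p \<times> 'q \<Rightarrow> 'a) \<Rightarrow> 'a \<Rightarrow> 'a \<Rightarrow> ('p \<times> 'q) set \<Rightarrow> 'a::bounded_semilattice_sup_bot" where
  "grid_map w a b x =
     sup (if finite x then Sup_fin (insert bot (w ` x)) else bot)
       (sup (if finite (snd ` x) then bot else a) (if finite (fst ` x) then bot else b))"

lemma finite_fst_snd_imp_finite: "finite (fst ` x) \<Longrightarrow> finite (snd ` x) \<Longrightarrow> finite x"
  by (rule finite_subset[of _ "fst ` x \<times> snd ` x"]) force+

lemma join_zero_hom_on_grid_map:
  fixes a b :: "'a::bounded_semilattice_sup_bot"
  assumes w: "\<And>z. w z \<le> a" "\<And>z. w z \<le> b"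
  shows "join_zero_hom_on UNIV sup bot (grid_map w a b)"
proof -
  define W where "W x = (if finite x then Sup_fin (insert bot (w ` x)) else bot)" for x
  define N where "N x = sup (if finite (snd ` x) then bot else a) (if finite (fst ` x) then bot else b)"
    for x :: "('b \<times> 'c) set"
  have g: "grid_map w a b x = sup (W x) (N x)" for x
    unfolding grid_map_def W_def N_def ..
  have W_le: "W x \<le> a" "W x \<le> b" for x
    unfolding W_def using w by (auto intro!: Sup_fin.boundedI)
  \<comment> \<open>An infinite set has an infinite projection, so its \<open>N\<close> is above
    \<open>a\<close> or \<open>b\<close>, while joins of weights are below both.\<close>
  have W_N: "W x \<le> N y" if "infinite y" for x y
  proof -
    have "infinite (fst ` y) \<or> infinite (snd ` y)"
      using that finite_fst_snd_imp_finite by blast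
    then show ?thesis
      using W_le[of x] unfolding N_def by (auto intro: le_supI1 le_supI2)
  qed
  have N_Un: "N (x \<union> y) = sup (N x) (N y)" for x y
    unfolding N_def by (auto simp: image_Un ac_simps)
  have "grid_map w a b (x \<union> y) = sup (grid_map w a b x) (grid_map w a b y)" for x y
  proof (cases "finite (x \<union> y)")
    case True
    then have "W (x \<union> y) = sup (W x) (W y)"
      using Sup_fin.union[of "insert bot (w ` x)" "insert bot (w ` y)"]
      by (simp add: W_def image_Un)
    then show ?thesis
      by (simp add: g N_Un ac_simps)
  next
    case False
    then have "sup (W z) (N (x \<union> y)) = N (x \<union> y)" for z
      by (intro sup_absorb2 W_N)
    then have "sup (W x) (sup (W y) (N (x \<union> y))) = sup (W (x \<union> y)) (N (x \<union> y))"
      by simp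
    then show ?thesis
      by (simp add: g N_Un ac_simps)
  qed
  moreover have "grid_map w a b {} = bot"
    by (simp add: grid_map_def)
  ultimately show ?thesis
    by (simp add: join_zero_hom_on_def)
qed

section \<open>The diagonal argument\<close>

lemma hom_splitting_property_imp_meet:
  fixes a b :: "'a::bounded_semilattice_sup_bot"
  assumes inf: "infinite (UNIV :: 'a set)"
    and split: "hom_splitting_property TYPE((('a \<Rightarrow> 'a) \<times> 'a) set) TYPE('a)"
  shows "\<exists>m. m \<le> a \<and> m \<le> b \<and> (\<forall>c. c \<le> a \<and> c \<le> b \<longrightarrow> c \<le> m)"
proof (rule ccontr)
  assume no_meet: "\<not> ?thesis"
  \<comment> \<open>The default \<open>bot\<close> makes every weight a common lower bound, as the
    homomorphism property requires.\<close>
  define w where "w z = (if fst z (snd z) \<le> a \<and> fst z (snd z) \<le> b then fst z (snd z) else bot)"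
    for z :: "('a \<Rightarrow> 'a) \<times> 'a"
  have w: "w z \<le> a" "w z \<le> b" for z
    by (auto simp: w_def)
  define \<mu> where "\<mu> = grid_map w a b"
  have "infinite (UNIV :: ('a \<Rightarrow> 'a) set)"
    using inf by (auto simp: finite_fun_UNIVD2)
  then have "\<mu> UNIV = sup a b"
    using inf by (simp add: \<mu>_def grid_map_def finite_prod)
  moreover have hom: "join_zero_hom_on UNIV sup bot \<mu>"
    unfolding \<mu>_def by (rule join_zero_hom_on_grid_map) (rule w)+
  ultimately obtain \<mu>0 \<mu>1 :: "(('a \<Rightarrow> 'a) \<times> 'a) set \<Rightarrow> 'a"
    where hom0: "join_zero_hom_on UNIV sup bot \<mu>0" and hom1: "join_zero_hom_on UNIV sup bot \<mu>1"
      and sup: "\<And>x. \<mu> x = sup (\<mu>0 x) (\<mu>1 x)" and "\<mu>0 UNIV = a" "\<mu>1 UNIV = b"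
    using split[unfolded hom_splitting_property_def, rule_format, OF boolean_algebra_on_UNIV,
        of \<mu> a b] by auto
  have mono0: "\<mu>0 x \<le> \<mu>0 y" if "x \<subseteq> y" for x y
    using that by (intro join_zero_hom_on_mono[OF hom0]) auto
  have mono1: "\<mu>1 x \<le> \<mu>1 y" if "x \<subseteq> y" for x y
    using that by (intro join_zero_hom_on_mono[OF hom1]) auto
  define u where "u i = \<mu>1 ({i} \<times> UNIV)" for i
  define v where "v j = \<mu>0 (UNIV \<times> {j})" for j
  \<comment> \<open>An infinite set inside one row has value \<open>a\<close>, which bounds
    \<open>u i\<close>; the bound \<open>b\<close> is monotonicity of \<open>\<mu>1\<close>. Columns
    are symmetric, with \<open>\<mu>0\<close>.\<close>
  have "\<mu> ({i} \<times> UNIV) \<le> a" for i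
    using inf by (auto simp: \<mu>_def grid_map_def dest: finite_cartesian_productD2)
  then have u: "u i \<le> a" "u i \<le> b" for i
    using sup[of "{i} \<times> UNIV"] mono1[of "{i} \<times> UNIV" UNIV] \<open>\<mu>1 UNIV = b\<close> unfolding u_def
    by (metis le_sup_iff, simp)
  have "\<mu> (UNIV \<times> {j}) \<le> b" for j
    using \<open>infinite (UNIV :: ('a \<Rightarrow> 'a) set)\<close>
    by (auto simp: \<mu>_def grid_map_def dest: finite_cartesian_productD1)
  then have v: "v j \<le> a" "v j \<le> b" for j
    using sup[of "UNIV \<times> {j}"] mono0[of "UNIV \<times> {j}" UNIV] \<open>\<mu>0 UNIV = a\<close> unfolding v_def
    by (simp, metis le_sup_iff)
  have le: "w (i, j) \<le> sup (u i) (v j)" for i j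
  proof -
    have "w (i, j) \<le> \<mu> {(i, j)}"
      by (simp add: \<mu>_def grid_map_def)
    \<comment> \<open>The cell lies in column \<open>j\<close>, which bounds \<open>\<mu>0\<close>,
      and in row \<open>i\<close>, which bounds \<open>\<mu>1\<close>.\<close>
    also have "\<dots> \<le> sup (v j) (u i)"
      unfolding sup u_def v_def by (intro sup_mono mono0 mono1) auto
    finally show ?thesis
      by (simp add: sup_commute)
  qed
  \<comment> \<open>For such \<open>j\<close>, \<open>sup j (v j)\<close> is a common lower bound
    but not the greatest, so some common lower bound \<open>c\<close> is not below it.\<close>
  have "\<forall>j. \<exists>c. j \<le> a \<and> j \<le> b \<longrightarrow> c \<le> a \<and> c \<le> b \<and> \<not> c \<le> sup j (v j)"
    using no_meet v by (metis le_sup_iff)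
  then obtain i where i: "\<And>j. j \<le> a \<Longrightarrow> j \<le> b \<Longrightarrow> i j \<le> a \<and> i j \<le> b \<and> \<not> i j \<le> sup j (v j)"
    by metis
  then show False
    using u[of i] le[of i "u i"] by (auto simp: w_def)
qed

lemma hom_splitting_property_imp_lattice:
  assumes "hom_splitting_property TYPE('a set set) TYPE('a::bounded_semilattice_sup_bot)"
  shows "semilattice_is_lattice TYPE('a)"
  unfolding semilattice_is_lattice_def
proof (intro allI)
  fix a b :: 'a
  show "\<exists>m. m \<le> a \<and> m \<le> b \<and> (\<forall>c. c \<le> a \<and> c \<le> b \<longrightarrow> c \<le> m)"
  proof (cases "finite (UNIV :: 'a set)")
    case True
    then show ?thesis
      by (intro finite_imp_meet) (rule finite_subset[OF subset_UNIV])
  next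
    case False
    then obtain h :: "('a \<Rightarrow> 'a) \<times> 'a \<Rightarrow> 'a set" where "inj h"
      using infinite_imp_inj_grid by blast
    \<comment> \<open>Taking images under \<open>h\<close> embeds the sets of cells into
      \<open>'a set set\<close>.\<close>
    then have "hom_splitting_property TYPE((('a \<Rightarrow> 'a) \<times> 'a) set) TYPE('a)"
      by (intro hom_splitting_property_inj[OF _ assms, of "(`) h"] injI)
        (simp add: inj_image_eq_iff)
    with False show ?thesis
      by (rule hom_splitting_property_imp_meet)
  qed
qed

theorem corollary1p4:
  assumes "distributive_semilattice TYPE('a::bounded_semilattice_sup_bot)"
  shows "(hom_splitting_property TYPE('a set set) TYPE('a) \<longleftrightarrow> semilattice_is_lattice TYPE('a))
       \<and> (semilattice_is_lattice TYPE('a) \<longrightarrow> hom_splitting_property TYPE('b) TYPE('a))"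
  by (intro conjI iffI impI)
    (erule hom_splitting_property_imp_lattice lattice_imp_hom_splitting_property[OF assms])+

end
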